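(* Let $R$ be a finite noncommutative ring such that $|R|\neq 8$, and let $r\in K(R)$. Then $\Delta_R^r$ is $1$-regular if and only if $r\neq 0$ and $R$ is isomorphic to $E(9)$ or $F(9)$.
   Context: Rings are associative and not assumed to have a unity. $[x,y]:=xy-yx$ and $K(R):=\{[x,y]:x,y\in R\}$. $Z(R)$ is the center of $R$. $\Delta_R^r$ is the simple undirected graph with vertex set $R\setminus Z(R)$ in which two distinct vertices $x,y$ are adjacent if and only if $[x,y]\neq r$ and $[x,y]\neq -r$. For a prime $p$, $E(p^2)=\langle a,b: pa=pb=0,\ a^2=a,\ b^2=b,\ ab=a,\ ba=b\rangle$ and $F(p^2)=\langle x,y: px=py=0,\ x^2=x,\ y^2=y,\ xy=y,\ yx=x\rangle$; these are (non-unital) rings of order $p^2$ whose additive group is free over $\mathbb{Z}/p$ on the two generators, with multiplication determined bilinearly by the given relations. *)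

theory Defs
  imports
    Main
    "HOL-Library.Numeral_Type"
    "Graph_Theory.Graph_Theory"
begin

text \<open>
  Rings are types of class \<^class>\<open>ring\<close>, the associative rings that need not have a unity.
\<close>

definition ring_comm :: "'a::ring \<Rightarrow> 'a \<Rightarrow> 'a"
  where "ring_comm x y = x * y - y * x"

definition ring_comms :: "'a::ring set"
  where "ring_comms = {ring_comm x y | x y. True}"

definition ring_center :: "'a::ring set"
  where "ring_center = {z. \<forall>x. z * x = x * z}"

text \<open>
  As usual with pair graphs, an undirected edge is a pair of opposite arcs. The lemma
  below confirms that the result is a simple graph when the ring is finite.
\<close>

definition noncomm_graph :: "'a::ring \<Rightarrow> 'a pair_pre_digraph"
  where "noncomm_graph r =
    \<lparr> pverts = UNIV - ring_center,
      parcs = {(x, y). x \<in> UNIV - ring_center \<and> y \<in> UNIV - ring_center \<and> x \<noteq> y \<and>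
                       ring_comm x y \<noteq> r \<and> ring_comm x y \<noteq> - r} \<rparr>"

lemma ring_comm_swap: "ring_comm y x = - ring_comm x y"
  by (simp add: ring_comm_def)

lemma pair_graph_noncomm_graph: "pair_graph (noncomm_graph (r :: 'a::{ring,finite}))"
proof -
  have "sym (parcs (noncomm_graph r))"
    unfolding sym_def noncomm_graph_def
    by clarsimp (metis ring_comm_swap minus_minus)
  then have "symmetric (with_proj (noncomm_graph r))"
    by (simp add: symmetric_def)
  then show ?thesis
    by unfold_locales (auto simp: noncomm_graph_def)
qed

text \<open>
  For a symmetric digraph the out-degree of a vertex is its degree as an undirected graph.
\<close>

definition regular_graph :: "nat \<Rightarrow> 'a pair_pre_digraph \<Rightarrow> bool"
  where "regular_graph k G \<longleftrightarrow> (\<forall>v \<in> pverts G. out_degree (with_proj G) v = k)"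

lemma out_degree_noncomm_graph:
  fixes r x :: "'a::ring"
  assumes "x \<notin> ring_center"
  shows "out_degree (with_proj (noncomm_graph r)) x =
    card {y. y \<notin> ring_center \<and> y \<noteq> x \<and> ring_comm x y \<noteq> r \<and> ring_comm x y \<noteq> - r}"
proof -
  have "out_arcs (with_proj (noncomm_graph r)) x =
    Pair x ` {y. y \<notin> ring_center \<and> y \<noteq> x \<and> ring_comm x y \<noteq> r \<and> ring_comm x y \<noteq> - r}"
    using assms by (auto simp: noncomm_graph_def out_arcs_def with_proj_def)
  then show ?thesis
    by (simp add: out_degree_def card_image inj_on_def)
qed

text \<open>
  The element \<open>E_ring i j\<close> stands for \<open>i a + j b\<close>, and the product is the bilinear
  extension of \<open>a\<^sup>2 = a\<close>, \<open>b\<^sup>2 = b\<close>, \<open>a b = a\<close>, \<open>b a = b\<close>. With the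
  integers modulo a prime \<open>p\<close> as coefficients, this is \<open>E(p\<^sup>2)\<close>; in particular
  \<open>E(9)\<close> is \<open>3 E_ring\<close>, the numeral type \<^typ>\<open>3\<close> being the integers modulo 3.
\<close>

datatype 'k E_ring = E_ring (E_a: 'k) (E_b: 'k)

instantiation E_ring :: (comm_ring) ring
begin

definition "0 = E_ring 0 0"
definition "u + v = E_ring (E_a u + E_a v) (E_b u + E_b v)"
definition "- u = E_ring (- E_a u) (- E_b u)"
definition "u - v = E_ring (E_a u - E_a v) (E_b u - E_b v)"
definition "u * v =
  E_ring (E_a u * E_a v + E_a u * E_b v) (E_b u * E_b v + E_b u * E_a v)"

instance
  by standard
    (simp_all add: zero_E_ring_def plus_E_ring_def uminus_E_ring_def minus_E_ring_def
      times_E_ring_def algebra_simps)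

end

text \<open>
  Similarly \<open>F_ring i j\<close> stands for \<open>i x + j y\<close>, with \<open>x\<^sup>2 = x\<close>,
  \<open>y\<^sup>2 = y\<close>, \<open>x y = y\<close>, \<open>y x = x\<close>.
\<close>

datatype 'k F_ring = F_ring (F_x: 'k) (F_y: 'k)

instantiation F_ring :: (comm_ring) ring
begin

definition "0 = F_ring 0 0"
definition "u + v = F_ring (F_x u + F_x v) (F_y u + F_y v)"
definition "- u = F_ring (- F_x u) (- F_y u)"
definition "u - v = F_ring (F_x u - F_x v) (F_y u - F_y v)"
definition "u * v =
  F_ring (F_x u * F_x v + F_y u * F_x v) (F_y u * F_y v + F_x u * F_y v)"

instance
  by standard
    (simp_all add: zero_F_ring_def plus_F_ring_def uminus_F_ring_def minus_F_ring_def
      times_F_ring_def algebra_simps)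

end

lemma E_ring_relations:
  fixes a b :: "'k::comm_ring_1 E_ring"
  defines "a \<equiv> E_ring 1 0" and "b \<equiv> E_ring 0 1"
  shows "a * a = a" "b * b = b" "a * b = a" "b * a = b"
  by (simp_all add: a_def b_def times_E_ring_def)

lemma F_ring_relations:
  fixes x y :: "'k::comm_ring_1 F_ring"
  defines "x \<equiv> F_ring 1 0" and "y \<equiv> F_ring 0 1"
  shows "x * x = x" "y * y = y" "x * y = y" "y * x = x"
  by (simp_all add: x_def y_def times_F_ring_def)

lemma E9_add_order: "u + u + u = (0 :: 3 E_ring)"
proof -
  have "t + t + t = 0" for t :: 3
  proof -
    have "t + t + t = 3 * t" by (simp add: algebra_simps)
    also have "(3 :: 3) = 0" by simp
    finally show ?thesis by simp
  qed
  then show ?thesis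
    by (simp add: plus_E_ring_def zero_E_ring_def)
qed

lemma F9_add_order: "u + u + u = (0 :: 3 F_ring)"
proof -
  have "t + t + t = 0" for t :: 3
  proof -
    have "t + t + t = 3 * t" by (simp add: algebra_simps)
    also have "(3 :: 3) = 0" by simp
    finally show ?thesis by simp
  qed
  then show ?thesis
    by (simp add: plus_F_ring_def zero_F_ring_def)
qed

lemma card_E9: "CARD(3 E_ring) = 9"
proof -
  have "bij (\<lambda>u :: 3 E_ring. (E_a u, E_b u))"
    by (rule bij_betw_byWitness[where f' = "\<lambda>(i, j). E_ring i j"]) auto
  then have "CARD(3 E_ring) = CARD(3 \<times> 3)"
    by (rule bij_betw_same_card)
  then show ?thesis by simp
qed

lemma card_F9: "CARD(3 F_ring) = 9"
proof -
  have "bij (\<lambda>u :: 3 F_ring. (F_x u, F_y u))"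
    by (rule bij_betw_byWitness[where f' = "\<lambda>(i, j). F_ring i j"]) auto
  then have "CARD(3 F_ring) = CARD(3 \<times> 3)"
    by (rule bij_betw_same_card)
  then show ?thesis by simp
qed

text \<open>The ring isomorphisms of \<open>HOL-Algebra\<close> preserve a unity, which is absent here.\<close>

definition is_ring_iso :: "('a::ring \<Rightarrow> 'b::ring) \<Rightarrow> bool"
  where "is_ring_iso f \<longleftrightarrow>
    bij f \<and> (\<forall>x y. f (x + y) = f x + f y) \<and> (\<forall>x y. f (x * y) = f x * f y)"

end

theory Submission
  imports Defs
begin

text \<open>
  If \<open>r \<noteq> 0\<close> and \<open>y\<close> is the only neighbour of \<open>x\<close>, then \<open>x\<close> and \<open>y\<close> commute, since otherwise
  \<open>x + y\<close> is a second neighbour. So \<open>x\<close> has all its commutators in \<open>{0, r, -r}\<close>, and its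
  centraliser is \<open>Z(R) \<union> {x, y}\<close>. As \<open>x + z\<close> lies there for each central \<open>z\<close>, the center has at
  most two elements. With two elements, \<open>2 x\<close> is central, hence \<open>2 r = 0\<close>, every centraliser of a
  noncentral element has index 2 and order 4, and \<open>|R| = 8\<close>. With a trivial center, the centraliser
  of \<open>x\<close> is \<open>{0, x, -x}\<close> and \<open>3 x = 0\<close>, so any two noncommuting elements span \<open>R\<close> over the integers
  modulo 3. Not all squares vanish, so there is an idempotent \<open>e \<noteq> 0\<close>; its Peirce decomposition
  gives a second generator with the relations of \<open>E(9)\<close> or of \<open>F(9)\<close>.
\<close>

section \<open>Neighbourhoods and their transport along ring isomorphisms\<close>

lemma regular_noncomm_graph_iff:
  "regular_graph k (noncomm_graph (r::'a::ring)) \<longleftrightarrow>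
    (\<forall>x. x \<notin> ring_center \<longrightarrow>
      card {y. y \<notin> ring_center \<and> y \<noteq> x \<and> ring_comm x y \<noteq> r \<and> ring_comm x y \<noteq> - r} = k)"
proof -
  have "pverts (noncomm_graph r) = UNIV - ring_center"
    by (simp add: noncomm_graph_def)
  then show ?thesis
    by (auto simp: regular_graph_def out_degree_noncomm_graph)
qed

lemma ring_iso_zero:
  assumes "is_ring_iso f"
  shows "f 0 = 0"
proof -
  have "f (0 + 0) = f 0 + f 0"
    using assms unfolding is_ring_iso_def by blast
  then show ?thesis
    by simp
qed

lemma ring_iso_minus:
  assumes "is_ring_iso f"
  shows "f (- x) = - f x"
proof -
  have "f (- x + x) = f (- x) + f x"
    using assms unfolding is_ring_iso_def by blast
  then show ?thesis
    by (simp add: ring_iso_zero[OF assms] eq_neg_iff_add_eq_0)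
qed

lemma ring_iso_inj: "is_ring_iso f \<Longrightarrow> f x = f y \<longleftrightarrow> x = y"
  by (simp add: is_ring_iso_def bij_def inj_eq)

lemma ring_iso_comm: "is_ring_iso f \<Longrightarrow> f (ring_comm x y) = ring_comm (f x) (f y)"
proof -
  assume f: "is_ring_iso f"
  then have "f (x * y + - (y * x)) = f x * f y + - (f y * f x)"
    using f by (simp add: ring_iso_minus[OF f] is_ring_iso_def del: add_uminus_conv_diff)
  then show ?thesis
    by (simp add: ring_comm_def)
qed

lemma ring_iso_eq_zero_iff: "is_ring_iso f \<Longrightarrow> f x = 0 \<longleftrightarrow> x = 0"
  using ring_iso_inj[of f x 0] ring_iso_zero[of f] by simp

lemma ring_iso_comms: "is_ring_iso f \<Longrightarrow> x \<in> ring_comms \<Longrightarrow> f x \<in> ring_comms"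
  unfolding ring_comms_def using ring_iso_comm by blast

lemma ring_center_iff_comm: "x \<in> ring_center \<longleftrightarrow> (\<forall>y. ring_comm x y = 0)"
  by (simp add: ring_center_def ring_comm_def)

lemma ring_iso_center:
  assumes f: "is_ring_iso f"
  shows "f x \<in> ring_center \<longleftrightarrow> x \<in> ring_center"
proof -
  have "surj f"
    using f by (simp add: is_ring_iso_def bij_def)
  then have "f x \<in> ring_center \<longleftrightarrow> (\<forall>y. ring_comm (f x) (f y) = 0)"
    unfolding ring_center_iff_comm by (metis surjD)
  also have "\<dots> \<longleftrightarrow> (\<forall>y. f (ring_comm x y) = f 0)"
    by (simp add: ring_iso_comm[OF f] ring_iso_zero[OF f])
  finally show ?thesis
    by (simp add: ring_iso_inj[OF f] ring_center_iff_comm)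
qed

text \<open>The neighbourhood of \<open>f x\<close> is the image of that of \<open>x\<close>, so the
  degrees agree. Regularity is pulled back from the codomain, where it can be checked by
  computation.\<close>

lemma ring_iso_regular:
  fixes f :: "'a::ring \<Rightarrow> 'b::ring"
  assumes f: "is_ring_iso f"
    and reg: "regular_graph k (noncomm_graph (f r))"
  shows "regular_graph k (noncomm_graph r)"
  unfolding regular_noncomm_graph_iff
proof (intro allI impI)
  fix x :: 'a
  assume x: "x \<notin> ring_center"
  let ?N = "{y. y \<notin> ring_center \<and> y \<noteq> x \<and> ring_comm x y \<noteq> r \<and> ring_comm x y \<noteq> - r}"
  let ?M = "{y. y \<notin> ring_center \<and> y \<noteq> f x \<and> ring_comm (f x) y \<noteq> f r \<and> ring_comm (f x) y \<noteq> - f r}"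
  have "surj f" "inj f"
    using f by (simp_all add: is_ring_iso_def bij_def)
  have mem: "f y \<in> ?M \<longleftrightarrow> y \<in> ?N" for y
    by (simp add: ring_iso_center[OF f] ring_iso_inj[OF f]
        flip: ring_iso_comm[OF f] ring_iso_minus[OF f])
  have image: "?M = f ` ?N"
  proof (intro equalityI subsetI)
    fix v
    assume v: "v \<in> ?M"
    obtain y where y: "v = f y"
      using \<open>surj f\<close> by (metis surjD)
    then have "y \<in> ?N"
      using v by (simp only: mem)
    with y show "v \<in> f ` ?N"
      by (rule image_eqI)
  next
    fix v
    assume "v \<in> f ` ?N"
    then obtain y where "v = f y" "y \<in> ?N"
      by (rule imageE)
    then show "v \<in> ?M"
      by (simp only: mem)
  qed
  have "card ?M = card ?N"
    unfolding image by (rule card_image[OF inj_on_subset[OF \<open>inj f\<close> subset_UNIV]])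
  have "f x \<notin> ring_center"
    using x by (simp only: ring_iso_center[OF f] not_False_eq_True)
  then have "card ?M = k"
    by (rule reg[unfolded regular_noncomm_graph_iff, rule_format])
  with \<open>card ?M = card ?N\<close> show "card ?N = k"
    by (rule trans[OF sym])
qed

section \<open>Regularity of the graphs of E(9) and F(9)\<close>

text \<open>The signed representatives match the sets \<open>{0, x, -x}\<close> that occur as
  centralisers and as sets of commutator values.\<close>

lemma mod3_cases:
  fixes k :: 3
  obtains "k = 0" | "k = 1" | "k = -1"
proof -
  have "{0, 1, -1} = (UNIV :: 3 set)"
    by (rule card_seteq) auto
  then have "k \<in> {0, 1, -1}"
    by (metis UNIV_I)
  then show thesis
    using that by blast
qed

text \<open>A nonzero commutator \<open>r\<close> must be \<open>c\<close> or \<open>- c\<close>, so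
  being adjacent to \<open>x\<close> means being noncentral, distinct from \<open>x\<close> and
  commuting with \<open>x\<close>. Only \<open>- x\<close> qualifies.\<close>

lemma regular_if_comms:
  fixes r c :: "'a::ring"
  assumes torsion: "\<And>x::'a. x \<noteq> 0 \<Longrightarrow> x \<noteq> - x"
    and cent: "\<And>x y::'a. x \<noteq> 0 \<Longrightarrow> ring_comm x y = 0 \<longleftrightarrow> y \<in> {0, x, -x}"
    and center: "ring_center = {0::'a}"
    and comms: "\<And>x y::'a. ring_comm x y \<in> {0, c, -c}"
    and r: "r \<in> ring_comms" "r \<noteq> 0"
  shows "regular_graph 1 (noncomm_graph r)"
proof -
  have "r = c \<or> r = - c"
    using r comms unfolding ring_comms_def by fastforce
  then have comms_r: "ring_comm x y \<in> {0, r, -r}" for x y :: 'a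
    using comms[of x y] by auto
  have "{y. y \<notin> ring_center \<and> y \<noteq> x \<and> ring_comm x y \<noteq> r \<and> ring_comm x y \<noteq> - r} = {-x}"
    if "x \<noteq> 0" for x
  proof -
    have "ring_comm x y \<noteq> r \<and> ring_comm x y \<noteq> - r \<longleftrightarrow> y \<in> {0, x, -x}" for y
      using comms_r[of x y] r(2) cent[OF that, of y] by auto
    then show ?thesis
      using torsion[OF that] that by (auto simp: center)
  qed
  then show ?thesis
    by (simp add: regular_noncomm_graph_iff center)
qed

text \<open>A determinant over the field with three elements: it vanishes exactly when
  \<open>(k, l)\<close> is a multiple of the nonzero vector \<open>(i, j)\<close>, and the scalars
  are 0, 1, -1.\<close>

lemma mod3_proportional:
  fixes i j k l :: 3
  assumes "i \<noteq> 0 \<or> j \<noteq> 0"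
  shows "i * l - k * j = 0 \<longleftrightarrow> k = 0 \<and> l = 0 \<or> k = i \<and> l = j \<or> k = - i \<and> l = - j"
  using assms
  by (cases i rule: mod3_cases; cases j rule: mod3_cases;
      cases k rule: mod3_cases; cases l rule: mod3_cases) simp_all

lemma E9_regular:
  fixes r :: "3 E_ring"
  assumes "r \<in> ring_comms" "r \<noteq> 0"
  shows "regular_graph 1 (noncomm_graph r)"
proof (rule regular_if_comms[OF _ _ _ _ assms, where c = "E_ring 1 (-1)"])
  fix x y :: "3 E_ring"
  obtain i j where x: "x = E_ring i j" by (cases x)
  obtain k l where y: "y = E_ring k l" by (cases y)
  \<comment> \<open>Every commutator is the determinant of the coordinates times the fixed element
    \<open>E_ring 1 (-1)\<close>.\<close>
  have comm: "ring_comm x y = E_ring (i * l - k * j) (- (i * l - k * j))"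
    by (simp add: x y ring_comm_def minus_E_ring_def times_E_ring_def algebra_simps)
  show "x \<noteq> 0 \<Longrightarrow> x \<noteq> - x"
    unfolding x by (cases i rule: mod3_cases; cases j rule: mod3_cases)
      (simp_all add: zero_E_ring_def uminus_E_ring_def)
  show "ring_comm x y = 0 \<longleftrightarrow> y \<in> {0, x, -x}" if "x \<noteq> 0"
  proof -
    have "i \<noteq> 0 \<or> j \<noteq> 0"
      using that by (auto simp: x zero_E_ring_def)
    then show ?thesis
      unfolding comm using mod3_proportional[of i j l k]
      by (auto simp: x y zero_E_ring_def uminus_E_ring_def)
  qed
  show "ring_comm x y \<in> {0, E_ring 1 (-1), - E_ring 1 (-1)}"
    unfolding comm by (cases "i * l - k * j" rule: mod3_cases)
      (simp_all only: zero_E_ring_def uminus_E_ring_def E_ring.sel minus_minus minus_zero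
        insert_iff simp_thms)
next
  have "u = 0" if "u \<in> ring_center" for u :: "3 E_ring"
  proof -
    \<comment> \<open>Commuting with one generator kills the coordinate of the other.\<close>
    have "u * E_ring 1 0 = E_ring 1 0 * u" "u * E_ring 0 1 = E_ring 0 1 * u"
      using that by (simp_all add: ring_center_def)
    then show ?thesis
      by (cases u) (simp add: times_E_ring_def zero_E_ring_def)
  qed
  then show "ring_center = {0 :: 3 E_ring}"
    by (auto simp: ring_center_def)
qed

lemma F9_regular:
  fixes r :: "3 F_ring"
  assumes "r \<in> ring_comms" "r \<noteq> 0"
  shows "regular_graph 1 (noncomm_graph r)"
proof (rule regular_if_comms[OF _ _ _ _ assms, where c = "F_ring 1 (-1)"])
  fix x y :: "3 F_ring"
  obtain i j where x: "x = F_ring i j" by (cases x)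
  obtain k l where y: "y = F_ring k l" by (cases y)
  \<comment> \<open>F(9) is the opposite ring of E(9), so the commutator changes sign.\<close>
  have comm: "ring_comm x y = F_ring (- (i * l - k * j)) (i * l - k * j)"
    by (simp add: x y ring_comm_def minus_F_ring_def times_F_ring_def algebra_simps)
  show "x \<noteq> 0 \<Longrightarrow> x \<noteq> - x"
    unfolding x by (cases i rule: mod3_cases; cases j rule: mod3_cases)
      (simp_all add: zero_F_ring_def uminus_F_ring_def)
  show "ring_comm x y = 0 \<longleftrightarrow> y \<in> {0, x, -x}" if "x \<noteq> 0"
  proof -
    have "i \<noteq> 0 \<or> j \<noteq> 0"
      using that by (auto simp: x zero_F_ring_def)
    then show ?thesis
      unfolding comm using mod3_proportional[of i j l k]
      by (auto simp: x y zero_F_ring_def uminus_F_ring_def)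
  qed
  show "ring_comm x y \<in> {0, F_ring 1 (-1), - F_ring 1 (-1)}"
    unfolding comm by (cases "i * l - k * j" rule: mod3_cases)
      (simp_all only: zero_F_ring_def uminus_F_ring_def F_ring.sel minus_minus minus_zero
        insert_iff simp_thms)
next
  have "u = 0" if "u \<in> ring_center" for u :: "3 F_ring"
  proof -
    have "u * F_ring 1 0 = F_ring 1 0 * u" "u * F_ring 0 1 = F_ring 0 1 * u"
      using that by (simp_all add: ring_center_def)
    then show ?thesis
      by (cases u) (simp add: times_F_ring_def zero_F_ring_def)
  qed
  then show "ring_center = {0 :: 3 F_ring}"
    by (auto simp: ring_center_def)
qed

section \<open>Coordinates modulo 3 and recognition of E(9) and F(9)\<close>

text \<open>The last branch is the scalar -1. This is a genuine scalar action of the integers modulo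
  3 on elements with \<open>x + x + x = 0\<close>.\<close>

definition scale3 :: "3 \<Rightarrow> 'a::ring \<Rightarrow> 'a"
  where "scale3 k x = (if k = 0 then 0 else if k = 1 then x else - x)"

lemma scale3_simps [simp]:
  "scale3 0 x = 0" "scale3 1 x = x" "scale3 (-1) x = - x"
  by (simp_all add: scale3_def)

lemma scale3_add:
  assumes "x + x + x = 0"
  shows "scale3 (i + j) x = scale3 i x + scale3 j x"
proof -
  have "x + x = - x"
    using assms by (simp add: eq_neg_iff_add_eq_0)
  moreover from this have "- x - x = x"
    by (metis minus_add_distrib minus_minus diff_conv_add_uminus)
  \<comment> \<open>The scalar sums \<open>1 + 1\<close> and \<open>-1 - 1\<close> turn up as these
    numerals.\<close>
  moreover have "scale3 2 x = - x" "scale3 (- 2) x = x"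
    by (simp_all add: scale3_def)
  ultimately show ?thesis
    by (cases i rule: mod3_cases; cases j rule: mod3_cases) simp_all
qed

text \<open>The representatives 0, 1, -1 multiply modulo 3 as they do in the integers, so the rules
  of signs suffice.\<close>

lemma scale3_mult: "scale3 i x * scale3 j y = scale3 (i * j) (x * y)"
  by (cases i rule: mod3_cases; cases j rule: mod3_cases) simp_all

text \<open>Noncommuting elements are linearly independent: a nontrivial relation would make
  \<open>b\<close> a multiple of \<open>e\<close>, or \<open>e\<close> zero, and then the two would
  commute.\<close>

lemma scale3_inj_pair:
  fixes e b :: "'a::ring" and i j k l :: 3
  assumes ne: "e * b \<noteq> b * e"
    and eq: "scale3 i e + scale3 j b = scale3 k e + scale3 l b"
    and tor: "\<And>x::'a. x + x + x = 0"
  shows "i = k \<and> j = l"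
proof -
  have diff: "scale3 (i - k) x = scale3 i x - scale3 k x" for i k and x :: 'a
    using scale3_add[OF tor, of "i - k" k x] by (simp add: eq_diff_eq)
  have z: "scale3 (i - k) e + scale3 (j - l) b = 0"
    using eq unfolding diff by (simp add: algebra_simps)
  have "e \<noteq> 0"
    using ne by auto
  have j: "j - l = 0"
  proof (cases "j - l" rule: mod3_cases)
    case 2
    then have "b = - scale3 (i - k) e"
      using z by (simp add: eq_neg_iff_add_eq_0 add.commute)
    then show ?thesis
      using ne by (cases "i - k" rule: mod3_cases) simp_all
  next
    case 3
    then have "b = scale3 (i - k) e"
      using z by simp
    then show ?thesis
      using ne by (cases "i - k" rule: mod3_cases) simp_all
  qed
  then have "scale3 (i - k) e = 0"
    using z by simp
  then have "i - k = 0"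
    using \<open>e \<noteq> 0\<close> by (cases "i - k" rule: mod3_cases) simp_all
  with j show ?thesis
    by simp
qed

lemma is_ring_iso_inv:
  assumes g: "is_ring_iso g"
  shows "is_ring_iso (inv g)"
proof -
  have "bij g"
    using g by (simp add: is_ring_iso_def)
  moreover have "inv g (x + y) = inv g x + inv g y" "inv g (x * y) = inv g x * inv g y" for x y
    using g by (auto simp: is_ring_iso_def bij_is_inj bij_is_surj surj_f_inv_f
        intro!: inv_f_eq)
  ultimately show ?thesis
    by (simp add: is_ring_iso_def bij_imp_bij_inv)
qed

text \<open>The isomorphism is built in the opposite direction, from coordinates to
  \<open>'a\<close>, where it is given by a formula, and then inverted.\<close>

lemma ring_iso_E9:
  fixes e b :: "'a::ring"
  assumes rel: "e * e = e" "b * b = b" "e * b = e" "b * e = b" "e \<noteq> b"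
    and tor: "\<And>x::'a. x + x + x = 0"
    and span: "\<And>v. \<exists>i j. v = scale3 i e + scale3 j b"
  shows "\<exists>f :: 'a \<Rightarrow> 3 E_ring. is_ring_iso f"
proof -
  define g :: "3 E_ring \<Rightarrow> 'a" where "g u = scale3 (E_a u) e + scale3 (E_b u) b" for u
  have ne: "e * b \<noteq> b * e"
    using rel by simp
  have "inj g"
    by (rule injI) (simp add: g_def scale3_inj_pair[OF ne _ tor] E_ring.expand)
  moreover have "surj g"
    unfolding surj_def g_def using span by (metis E_ring.sel)
  moreover have "g (u + v) = g u + g v" "g (u * v) = g u * g v" for u v
    by (simp_all add: g_def plus_E_ring_def times_E_ring_def scale3_add[OF tor]
        scale3_mult distrib_left distrib_right rel)
  ultimately have "is_ring_iso g"
    by (simp add: is_ring_iso_def bij_def)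
  then show ?thesis
    using is_ring_iso_inv by blast
qed

lemma ring_iso_F9:
  fixes e b :: "'a::ring"
  assumes rel: "e * e = e" "b * b = b" "e * b = b" "b * e = e" "e \<noteq> b"
    and tor: "\<And>x::'a. x + x + x = 0"
    and span: "\<And>v. \<exists>i j. v = scale3 i e + scale3 j b"
  shows "\<exists>f :: 'a \<Rightarrow> 3 F_ring. is_ring_iso f"
proof -
  define g :: "3 F_ring \<Rightarrow> 'a" where "g u = scale3 (F_x u) e + scale3 (F_y u) b" for u
  have ne: "e * b \<noteq> b * e"
    using rel by simp
  have "inj g"
    by (rule injI) (simp add: g_def scale3_inj_pair[OF ne _ tor] F_ring.expand)
  moreover have "surj g"
    unfolding surj_def g_def using span by (metis F_ring.sel)
  moreover have "g (u + v) = g u + g v" "g (u * v) = g u * g v" for u v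
    by (simp_all add: g_def plus_F_ring_def times_F_ring_def scale3_add[OF tor]
        scale3_mult distrib_left distrib_right rel)
  ultimately have "is_ring_iso g"
    by (simp add: is_ring_iso_def bij_def)
  then show ?thesis
    using is_ring_iso_inv by blast
qed

section \<open>An idempotent and its Peirce decomposition\<close>

text \<open>If all squares vanish, elements anticommute and \<open>x * y\<close> commutes with both
  \<open>x\<close> and \<open>y\<close>. If it were nonzero, it would be both \<open>x\<close> and
  \<open>y\<close> up to sign, so \<open>x\<close> and \<open>y\<close> would commute; hence it is
  zero, and so is \<open>y * x\<close>.\<close>

lemma exists_square_nonzero:
  assumes noncommutative: "\<exists>x y :: 'a::ring. x * y \<noteq> y * x"
    and cent: "\<And>x y::'a. x \<noteq> 0 \<Longrightarrow> x * y = y * x \<Longrightarrow> y \<in> {0, x, -x}"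
  shows "\<exists>u::'a. u * u \<noteq> 0"
proof (rule ccontr)
  assume "\<not> ?thesis"
  then have sq: "u * u = 0" for u :: 'a
    by simp
  obtain x y :: 'a where xy: "x * y \<noteq> y * x"
    using noncommutative by blast
  then have nz: "x \<noteq> 0" "y \<noteq> 0"
    by auto
  have "(x + y) * (x + y) = x * y + y * x"
    using sq[of x] sq[of y] by (simp add: distrib_left distrib_right)
  then have anti: "y * x = - (x * y)"
    using sq[of "x + y"] by (simp add: eq_neg_iff_add_eq_0 add.commute)
  have xxy: "x * (x * y) = 0"
    by (simp add: sq flip: mult.assoc)
  have xyy: "x * y * y = 0"
    by (simp add: sq mult.assoc)
  have "x * y * x = 0"
    unfolding mult.assoc anti by (simp add: xxy)
  moreover have "y * (x * y) = 0"
    unfolding mult.assoc[symmetric] anti by (simp add: xyy)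
  ultimately have "x * y \<in> {0, x, -x}" "x * y \<in> {0, y, -y}"
    using cent[OF nz(1), of "x * y"] cent[OF nz(2), of "x * y"] xxy xyy by simp_all
  then have "x * y = 0"
    using xy by (elim insertE emptyE) auto
  then show False
    using xy anti by simp
qed

lemma ring_iso_E9_or_F9:
  assumes noncommutative: "\<exists>x y :: 'a::ring. x * y \<noteq> y * x"
    and tor: "\<And>x::'a. x + x + x = 0"
    and cent: "\<And>x y::'a. x \<noteq> 0 \<Longrightarrow> x * y = y * x \<Longrightarrow> y \<in> {0, x, -x}"
    and center: "\<And>x::'a. x \<noteq> 0 \<Longrightarrow> \<exists>y. x * y \<noteq> y * x"
    and span: "\<And>x y v::'a. x * y \<noteq> y * x \<Longrightarrow> \<exists>i j. v = scale3 i x + scale3 j y"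
  shows "(\<exists>f :: 'a \<Rightarrow> 3 E_ring. is_ring_iso f) \<or> (\<exists>f :: 'a \<Rightarrow> 3 F_ring. is_ring_iso f)"
proof -
  obtain u :: 'a where u: "u * u \<noteq> 0"
    using exists_square_nonzero[OF noncommutative cent] by blast
  then have "u \<noteq> 0"
    by auto
  then have "u * u \<in> {0, u, -u}"
    using cent[of u "u * u"] by (simp add: mult.assoc)
  \<comment> \<open>If \<open>u * u = - u\<close>, the idempotent is \<open>- u\<close>.\<close>
  then have "u * u = u \<or> (- u) * (- u) = - u"
    using u by auto
  then obtain e :: 'a where e: "e * e = e" "e \<noteq> 0"
    using \<open>u \<noteq> 0\<close> by (metis neg_equal_0_iff_equal)
  obtain y where y: "e * y \<noteq> y * e"
    using center[OF e(2)] by blast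
  \<comment> \<open>The off-diagonal Peirce components of \<open>y\<close>: formally
    \<open>w\<close> is \<open>(1 - e) y e\<close> and \<open>z\<close> is
    \<open>e y (1 - e)\<close>, expanded because there may be no unity.\<close>
  define w where "w = y * e - e * y * e"
  define z where "z = e * y - e * y * e"
  have ee: "e * (e * x) = e * x" for x
    by (metis e(1) mult.assoc)
  have w: "e * w = 0" "w * e = w"
    by (simp_all add: w_def algebra_simps e ee)
  have z: "e * z = z" "z * e = 0"
    by (simp_all add: z_def algebra_simps e ee)
  \<comment> \<open>Insert \<open>e\<close> between the two factors:
    \<open>w * w = w * (e * w)\<close> and \<open>z * z = (z * e) * z\<close>.\<close>
  have ww: "w * w = 0" and zz: "z * z = 0"
    by (metis w z mult.assoc mult_zero_left mult_zero_right)+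
  \<comment> \<open>The difference \<open>z - w\<close> is the commutator of \<open>e\<close> and
    \<open>y\<close>.\<close>
  have "w \<noteq> 0 \<or> z \<noteq> 0"
    using y by (auto simp: w_def z_def)
  then show ?thesis
  proof
    assume "w \<noteq> 0"
    have "e * (e + w) = e" "(e + w) * e = e + w" "(e + w) * (e + w) = e + w" "e \<noteq> e + w"
      using w ww e \<open>w \<noteq> 0\<close> by (simp_all add: distrib_left distrib_right)
    moreover from this have "\<exists>i j. v = scale3 i e + scale3 j (e + w)" for v
      by (intro span) simp
    ultimately show ?thesis
      using ring_iso_E9[of e "e + w"] e(1) tor by blast
  next
    assume "z \<noteq> 0"
    have "e * (e + z) = e + z" "(e + z) * e = e" "(e + z) * (e + z) = e + z" "e \<noteq> e + z"
      using z zz e \<open>z \<noteq> 0\<close> by (simp_all add: distrib_left distrib_right)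
    moreover from this have "\<exists>i j. v = scale3 i e + scale3 j (e + z)" for v
      by (intro span) simp
    ultimately show ?thesis
      using ring_iso_F9[of e "e + z"] e(1) tor by blast
  qed
qed

section \<open>Centralisers when the graph is 1-regular\<close>

lemma ring_comm_add_right: "ring_comm x (y + z) = ring_comm x y + ring_comm x z"
  by (simp add: ring_comm_def algebra_simps)

lemma ring_comm_add_left: "ring_comm (x + y) z = ring_comm x z + ring_comm y z"
  by (simp add: ring_comm_def algebra_simps)

lemma ring_comm_minus_right: "ring_comm x (- y) = - ring_comm x y"
  by (simp add: ring_comm_def)

lemma ring_comm_self: "ring_comm x x = 0"
  by (simp add: ring_comm_def)

lemma ring_comm_center: "z \<in> ring_center \<Longrightarrow> ring_comm x z = 0"
  by (simp add: ring_comm_def ring_center_def)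

lemma ring_center_add_iff:
  assumes "z \<in> ring_center"
  shows "x + z \<in> ring_center \<longleftrightarrow> x \<in> ring_center"
proof -
  have "ring_comm (x + z) y = ring_comm x y" for y
    using assms by (simp add: ring_comm_add_left ring_center_iff_comm)
  then show ?thesis
    by (simp add: ring_center_iff_comm)
qed

lemma zero_in_ring_center: "0 \<in> ring_center"
  by (simp add: ring_center_def)

text \<open>If \<open>x\<close> and \<open>y\<close> did not commute, \<open>x + y\<close> would
  have the same nonzero commutator with \<open>x\<close>, hence be noncentral and a second
  neighbour. This covers \<open>r = 0\<close> too, where it yields a contradiction.\<close>

lemma unique_neighbour:
  fixes r :: "'a::ring"
  assumes reg: "regular_graph 1 (noncomm_graph r)"
    and x: "x \<notin> ring_center"
  obtains y where
    "\<And>v. v \<notin> ring_center \<and> v \<noteq> x \<and> ring_comm x v \<noteq> r \<and> ring_comm x v \<noteq> - r \<longleftrightarrow> v = y"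
    "ring_comm x y = 0"
proof -
  let ?N = "{y. y \<notin> ring_center \<and> y \<noteq> x \<and> ring_comm x y \<noteq> r \<and> ring_comm x y \<noteq> - r}"
  have "card ?N = 1"
    using reg x by (simp add: regular_noncomm_graph_iff)
  then obtain y where N: "?N = {y}"
    by (auto simp: card_1_singleton_iff)
  have "ring_comm x y = 0"
  proof (rule ccontr)
    assume ne: "ring_comm x y \<noteq> 0"
    have "y \<in> ?N"
      using N by blast
    have eq: "ring_comm x (x + y) = ring_comm x y"
      by (simp add: ring_comm_add_right ring_comm_self)
    then have "x + y \<notin> ring_center"
      using ne ring_comm_center by metis
    moreover have "x + y \<noteq> x"
      using \<open>y \<in> ?N\<close> zero_in_ring_center by auto
    ultimately have "x + y \<in> ?N"
      using \<open>y \<in> ?N\<close> eq by simp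
    then have "x + y = y"
      using N by blast
    then show False
      using x by (simp add: zero_in_ring_center)
  qed
  with N show thesis
    using that by blast
qed

text \<open>For \<open>r = 0\<close> neighbours do not commute, whereas the unique neighbour does
  commute with \<open>x\<close>.\<close>

lemma regular_imp_nonzero:
  fixes r :: "'a::ring"
  assumes noncommutative: "\<exists>x y :: 'a. x * y \<noteq> y * x"
    and reg: "regular_graph 1 (noncomm_graph r)"
  shows "r \<noteq> 0"
proof
  assume "r = 0"
  obtain x :: 'a where "x \<notin> ring_center"
    using noncommutative by (auto simp: ring_center_def)
  from unique_neighbour[OF reg this] show False
    using \<open>r = 0\<close> by metis
qed

text \<open>A noncentral element other than \<open>x\<close> and its neighbour \<open>y\<close> is
  not adjacent to \<open>x\<close>, so its commutator with \<open>x\<close> is \<open>r\<close> or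
  \<open>- r\<close> and thus nonzero.\<close>

lemma regular_imp_centraliser:
  fixes r :: "'a::ring"
  assumes reg: "regular_graph 1 (noncomm_graph r)"
    and "r \<noteq> 0"
    and x: "x \<notin> ring_center"
  obtains y where "{v. ring_comm x v = 0} = ring_center \<union> {x, y}" "y \<noteq> x" "y \<notin> ring_center"
    "\<And>v. ring_comm x v \<in> {0, r, -r}"
proof -
  obtain y where
    y: "\<And>v. v \<notin> ring_center \<and> v \<noteq> x \<and> ring_comm x v \<noteq> r \<and> ring_comm x v \<noteq> - r \<longleftrightarrow> v = y"
      "ring_comm x y = 0"
    using unique_neighbour[OF reg x] by blast
  show thesis
  proof (rule that)
    have "ring_comm x v = 0 \<longleftrightarrow> v \<in> ring_center \<union> {x, y}" for v
      using y(1)[of v] y(2) \<open>r \<noteq> 0\<close> ring_comm_center[of v x] ring_comm_self[of x] by auto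
    then show "{v. ring_comm x v = 0} = ring_center \<union> {x, y}"
      by blast
    show "ring_comm x v \<in> {0, r, -r}" for v
      using y(1)[of v] y(2) ring_comm_center[of v x] ring_comm_self[of x] by auto
  qed (use y(1)[of y] in blast)+
qed

lemma regular_nontrivial_center:
  fixes r z :: "'a::{ring,finite}"
  assumes noncommutative: "\<exists>x y :: 'a. x * y \<noteq> y * x"
    and reg: "regular_graph 1 (noncomm_graph r)"
    and z: "z \<in> ring_center" "z \<noteq> 0"
  shows "CARD('a) = 8"
proof -
  have "r \<noteq> 0"
    using regular_imp_nonzero[OF noncommutative reg] .
  obtain x w :: 'a where xw: "ring_comm x w \<noteq> 0"
    using noncommutative by (auto simp: ring_comm_def)
  then have x: "x \<notin> ring_center"
    by (auto simp: ring_center_iff_comm)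
  obtain y where C: "{v. ring_comm x v = 0} = ring_center \<union> {x, y}" "y \<noteq> x" "y \<notin> ring_center"
    and comms: "\<And>v. ring_comm x v \<in> {0, r, -r}"
    using regular_imp_centraliser[OF reg \<open>r \<noteq> 0\<close> x] by blast
  \<comment> \<open>A nonzero central \<open>t\<close> is therefore determined as
    \<open>y - x\<close>.\<close>
  have y: "x + t = y" if "t \<in> ring_center" "t \<noteq> 0" for t
  proof -
    have "ring_comm x (x + t) = 0"
      using that by (simp add: ring_comm_add_right ring_comm_self ring_comm_center)
    moreover have "x + t \<notin> ring_center"
      using ring_center_add_iff[OF that(1)] x by blast
    moreover have "x + t \<noteq> x"
      using that by simp
    ultimately show ?thesis
      using C(1) by blast
  qed
  have Z: "ring_center = {0, z}"
    using y[OF z] y z zero_in_ring_center by (auto; metis add_left_cancel)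
  then have C4: "{v. ring_comm x v = 0} = {0, z, x, x + z}"
    using C(1) y[OF z] by auto
  have "x \<noteq> 0" "x \<noteq> z" "x + z \<noteq> 0"
    using x Z ring_center_add_iff[OF z(1), of x] by auto
  then have card_C: "card {v. ring_comm x v = 0} = 4"
    using C4 z by simp
  have "ring_comm x (x + x) = 0"
    by (simp add: ring_comm_add_right ring_comm_self)
  then have "x + x \<in> {0, z, x, x + z}"
    using C4 by blast
  \<comment> \<open>The noncentral candidates \<open>x\<close> and \<open>x + z\<close> would give
    \<open>x = 0\<close> and \<open>x = z\<close>.\<close>
  then have "x + x \<in> ring_center"
    using \<open>x \<noteq> 0\<close> \<open>x \<noteq> z\<close> Z by auto
  then have "ring_comm x w + ring_comm x w = 0"
    using ring_comm_add_left[of x x w] by (simp add: ring_center_iff_comm)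
  then have "- ring_comm x w = ring_comm x w"
    by (simp add: neg_eq_iff_add_eq_0)
  then have comms': "ring_comm x v = 0 \<or> ring_comm x v = ring_comm x w" for v
    using comms[of v] comms[of w] xw by auto
  \<comment> \<open>As \<open>v\<close> ranges over the ring, its commutator with \<open>x\<close>
    has a single nonzero value, so the elements not commuting with \<open>x\<close> form one coset
    of the centraliser.\<close>
  have coset: "{v. ring_comm x v \<noteq> 0} = (+) w ` {v. ring_comm x v = 0}"
  proof (intro equalityI subsetI)
    fix v
    assume "v \<in> {v. ring_comm x v \<noteq> 0}"
    then have "ring_comm x v = ring_comm x w"
      using comms'[of v] by blast
    then have "ring_comm x (v + - w) = 0"
      unfolding ring_comm_add_right ring_comm_minus_right by simp
    moreover have "v = w + (v + - w)"
      by simp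
    ultimately show "v \<in> (+) w ` {v. ring_comm x v = 0}"
      by blast
  qed (use xw in \<open>auto simp: ring_comm_add_right\<close>)
  have "card {v. ring_comm x v \<noteq> 0} = 4"
    unfolding coset by (simp add: card_image card_C)
  moreover have "CARD('a) = card {v. ring_comm x v = 0} + card {v. ring_comm x v \<noteq> 0}"
    by (subst card_Un_disjoint[symmetric]) (auto intro: arg_cong[where f = card])
  ultimately show ?thesis
    using card_C by simp
qed

lemma regular_trivial_center:
  fixes r :: "'a::ring"
  assumes noncommutative: "\<exists>x y :: 'a. x * y \<noteq> y * x"
    and reg: "regular_graph 1 (noncomm_graph r)"
    and center: "ring_center = {0::'a}"
  shows "(\<exists>f :: 'a \<Rightarrow> 3 E_ring. is_ring_iso f) \<or> (\<exists>f :: 'a \<Rightarrow> 3 F_ring. is_ring_iso f)"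
proof (rule ring_iso_E9_or_F9[OF noncommutative])
  have "r \<noteq> 0"
    using regular_imp_nonzero[OF noncommutative reg] .
  have C: "{v. ring_comm x v = 0} = {0, x, -x} \<and> x \<noteq> - x" if "x \<noteq> 0" for x :: 'a
  proof -
    have x: "x \<notin> ring_center"
      using that by (simp add: center)
    obtain y where C: "{v. ring_comm x v = 0} = {0} \<union> {x, y}" "y \<noteq> x" "y \<notin> {0}"
      by (rule regular_imp_centraliser[OF reg \<open>r \<noteq> 0\<close> x, unfolded center])
    have "ring_comm x y = 0"
      using C(1) by blast
    then have "ring_comm x (x + y) = 0"
      by (simp add: ring_comm_add_right ring_comm_self)
    then have "x + y \<in> {0, x, y}"
      using C(1) by blast
    \<comment> \<open>The values \<open>x\<close> and \<open>y\<close> for \<open>x + y\<close>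
      would make \<open>y\<close> or \<open>x\<close> zero, so \<open>x + y = 0\<close>.\<close>
    then have "y = - x"
      using that C(3) by (auto simp: eq_neg_iff_add_eq_0 add.commute)
    then show ?thesis
      using C by auto
  qed
  show tor: "x + x + x = 0" for x :: 'a
  proof (cases "x = 0")
    case False
    have "ring_comm x (x + x) = 0"
      by (simp add: ring_comm_add_right ring_comm_self)
    then have "x + x \<in> {0, x, -x}"
      using C[OF False] by blast
    moreover have "x + x \<noteq> 0"
      using C[OF False] by (simp add: eq_neg_iff_add_eq_0)
    ultimately have "x + x = - x"
      using False by auto
    then show ?thesis
      by simp
  qed simp
  show cent: "y \<in> {0, x, -x}" if "x \<noteq> 0" "x * y = y * x" for x y :: 'a
  proof -
    have "ring_comm x y = 0"
      using that by (simp add: ring_comm_def)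
    then show ?thesis
      using C[OF that(1)] by blast
  qed
  show "\<exists>y. x * y \<noteq> y * x" if "x \<noteq> 0" for x :: 'a
  proof -
    have "x \<notin> ring_center"
      using that by (simp add: center)
    then show ?thesis
      by (simp add: ring_center_def)
  qed
  show "\<exists>i j. v = scale3 i x + scale3 j y" if "x * y \<noteq> y * x" for x y v :: 'a
  proof -
    have xy: "ring_comm x y \<noteq> 0"
      using that by (simp add: ring_comm_def)
    then have "x \<noteq> 0"
      by (auto simp: ring_comm_def)
    then have x: "x \<notin> ring_center"
      by (simp add: center)
    have comms: "ring_comm x u \<in> {0, r, -r}" for u
      using regular_imp_centraliser[OF reg \<open>r \<noteq> 0\<close> x] by blast
    \<comment> \<open>Some multiple of \<open>y\<close> has the same commutator with
      \<open>x\<close> as \<open>v\<close>; subtracting it leaves an element of the centraliser,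
      that is, a multiple of \<open>x\<close>.\<close>
    have "\<exists>j. ring_comm x v = ring_comm x (scale3 j y)"
    proof -
      \<comment> \<open>The nonzero commutator of \<open>x\<close> and \<open>y\<close> is
        \<open>r\<close> up to sign.\<close>
      have "ring_comm x v \<in> {0, ring_comm x y, - ring_comm x y}"
        using comms[of v] comms[of y] xy by auto
      also have "\<dots> = {ring_comm x (scale3 0 y), ring_comm x (scale3 1 y), ring_comm x (scale3 (-1) y)}"
        by (simp add: ring_comm_minus_right ring_comm_center zero_in_ring_center)
      finally show ?thesis
        by blast
    qed
    then obtain j where "ring_comm x v = ring_comm x (scale3 j y)"
      by blast
    then have "ring_comm x (v + - scale3 j y) = 0"
      unfolding ring_comm_add_right ring_comm_minus_right by simp
    moreover have "{u. ring_comm x u = 0} = {0, x, -x}"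
      using C[OF \<open>x \<noteq> 0\<close>] by blast
    ultimately have "v + - scale3 j y \<in> {0, x, -x}"
      by blast
    then have "v - scale3 j y \<in> {scale3 0 x, scale3 1 x, scale3 (-1) x}"
      by simp
    then obtain i where "v - scale3 j y = scale3 i x"
      by blast
    then have "v = scale3 i x + scale3 j y"
      by (simp add: diff_eq_eq)
    then show ?thesis
      by blast
  qed
qed

theorem theorem4p7:
  fixes r :: "'a::{ring,finite}"
  assumes noncommutative: "\<exists>x y :: 'a. x * y \<noteq> y * x"
    and card: "CARD('a) \<noteq> 8"
    and r: "r \<in> ring_comms"
  shows "regular_graph 1 (noncomm_graph r) \<longleftrightarrow>
    r \<noteq> 0 \<and> ((\<exists>f :: 'a \<Rightarrow> 3 E_ring. is_ring_iso f) \<or> (\<exists>f :: 'a \<Rightarrow> 3 F_ring. is_ring_iso f))"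
proof
  assume reg: "regular_graph 1 (noncomm_graph r)"
  \<comment> \<open>A nonzero central element would force order 8.\<close>
  have "ring_center = {0::'a}"
    using regular_nontrivial_center[OF noncommutative reg] card zero_in_ring_center by blast
  then show "r \<noteq> 0 \<and>
    ((\<exists>f :: 'a \<Rightarrow> 3 E_ring. is_ring_iso f) \<or> (\<exists>f :: 'a \<Rightarrow> 3 F_ring. is_ring_iso f))"
    using regular_imp_nonzero[OF noncommutative reg]
      regular_trivial_center[OF noncommutative reg] by blast
next
  assume "r \<noteq> 0 \<and>
    ((\<exists>f :: 'a \<Rightarrow> 3 E_ring. is_ring_iso f) \<or> (\<exists>f :: 'a \<Rightarrow> 3 F_ring. is_ring_iso f))"
  then show "regular_graph 1 (noncomm_graph r)"
  proof (elim conjE disjE exE)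
    fix f :: "'a \<Rightarrow> 3 E_ring"
    assume "r \<noteq> 0" and f: "is_ring_iso f"
    \<comment> \<open>The image \<open>f r\<close> is again a nonzero commutator, so the computation
      in E(9) applies to it.\<close>
    then show ?thesis
      using ring_iso_regular[OF f E9_regular] ring_iso_comms[OF f r] ring_iso_eq_zero_iff[OF f]
      by blast
  next
    fix f :: "'a \<Rightarrow> 3 F_ring"
    assume "r \<noteq> 0" and f: "is_ring_iso f"
    then show ?thesis
      using ring_iso_regular[OF f F9_regular] ring_iso_comms[OF f r] ring_iso_eq_zero_iff[OF f]
      by blast
  qed
qed

end
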